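(* Let $n$ be a positive integer and $x=(x_1,\dots,x_n)$. Then $$P^{\mathrm{BC}_n}_{(1^n)}\bigl(x;t,-t^{1/2},0\bigr)=\sum_{y\in\mathbb{Z}}(-1)^y t^{\frac32y^2-y}\bigl(\dot e_{n-3y}(x)-\dot e_{n+2-3y}(x)\bigr).$$
   Context: $\dot e_r(x)=e_r(x_1,x_1^{-1},\dots,x_n,x_n^{-1})$ is the $r$-th elementary symmetric function in $2n$ variables, equal to $0$ for $r<0$ or $r>2n$. $(1^n)$ is the partition with $n$ parts equal to $1$. For a partition $\lambda$, $l(\lambda)$ is the number of parts and $m_i(\lambda)$ the multiplicity of parts equal to $i$; $(a;t)_m=\prod_{i=0}^{m-1}(1-at^i)$; $v_\lambda(t)=\frac{(t;t)_{n-l(\lambda)}}{(1-t)^{n-l(\lambda)}}\prod_{i\ge1}\frac{(t;t)_{m_i(\lambda)}}{(1-t)^{m_i(\lambda)}}$. Let $W=S_n\ltimes(\mathbb{Z}/2\mathbb{Z})^n$ act on rational functions in $x$ by permuting the $x_i$ and by $x_i\mapsto x_i^{-1}$. For $l(\lambda)\le n$ the $\mathrm{BC}_n$ Hall–Littlewood polynomial is $$P^{\mathrm{BC}_n}_{\lambda}(x;t,s_1,s_2)=\frac{1}{(s_1s_2;t)_{n-l(\lambda)}v_\lambda(t)}\sum_{w\in W}w\Biggl(\prod_{i=1}^n x_i^{-\lambda_i}\frac{(1-s_1x_i)(1-s_2x_i)}{1-x_i^2}\prod_{1\le i<j\le n}\frac{(tx_i-x_j)(1-tx_ix_j)}{(x_i-x_j)(1-x_ix_j)}\Biggr).$$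 *)

theory Defs
  imports "HOL-Combinatorics.Permutations" "HOL-Library.Groups_Big_Fun"
begin

text \<open>
  Variables are indexed from 0: \<open>x 0, \<dots>, x (n - 1)\<close>. A rational function of \<open>x\<close> is represented
  by a function on points \<open>x :: nat \<Rightarrow> 'a\<close> over a field. It has its intended value at points where no
  denominator vanishes; since \<open>'a\<close> is arbitrary it may be a field of rational functions in
  which the \<open>x i\<close> are indeterminates.

  Partitions are weakly decreasing lists of positive integers.
\<close>

definition qpoch :: "'a::comm_ring_1 \<Rightarrow> 'a \<Rightarrow> nat \<Rightarrow> 'a" where
  "qpoch a t m = (\<Prod>i<m. 1 - a * t ^ i)"

definition part :: "nat list \<Rightarrow> nat \<Rightarrow> nat" where
  "part \<mu> i = (if i < length \<mu> then \<mu> ! i else 0)"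

text \<open>The values \<open>i\<close> that are not parts of \<open>\<mu>\<close> have multiplicity 0 and contribute a factor 1.\<close>

definition v_coeff :: "nat \<Rightarrow> nat list \<Rightarrow> 'a::field \<Rightarrow> 'a" where
  "v_coeff n \<mu> t =
     qpoch t t (n - length \<mu>) / (1 - t) ^ (n - length \<mu>) *
     (\<Prod>i\<in>set \<mu>. qpoch t t (count_list \<mu> i) / (1 - t) ^ count_list \<mu> i)"

text \<open>
  The signed permutation \<open>(\<sigma>, A)\<close> substitutes \<open>x (\<sigma> i)\<close> for \<open>x i\<close>, inverted precisely when \<open>i \<in> A\<close>.
\<close>

definition hyperoctahedral :: "nat \<Rightarrow> ((nat \<Rightarrow> nat) \<times> nat set) set" where
  "hyperoctahedral n = {\<sigma>. \<sigma> permutes {..<n}} \<times> Pow {..<n}"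

definition act ::
  "(nat \<Rightarrow> nat) \<times> nat set \<Rightarrow> ((nat \<Rightarrow> 'a::field) \<Rightarrow> 'a) \<Rightarrow> (nat \<Rightarrow> 'a) \<Rightarrow> 'a" where
  "act w f x = f (\<lambda>i. if i \<in> snd w then inverse (x (fst w i)) else x (fst w i))"

definition BC_kernel ::
  "nat \<Rightarrow> nat list \<Rightarrow> 'a \<Rightarrow> 'a \<Rightarrow> 'a \<Rightarrow> (nat \<Rightarrow> 'a::field) \<Rightarrow> 'a" where
  "BC_kernel n \<mu> t s1 s2 x =
     (\<Prod>i<n. x i powi (- int (part \<mu> i)) * ((1 - s1 * x i) * (1 - s2 * x i) / (1 - x i ^ 2))) *
     (\<Prod>j<n. \<Prod>i<j. (t * x i - x j) * (1 - t * x i * x j) / ((x i - x j) * (1 - x i * x j)))"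

text \<open>The \<open>BC\<^sub>n\<close> Hall--Littlewood polynomial, for a partition \<open>\<mu>\<close> of length at most \<open>n\<close>.\<close>

definition HL_BC ::
  "nat \<Rightarrow> nat list \<Rightarrow> (nat \<Rightarrow> 'a) \<Rightarrow> 'a \<Rightarrow> 'a \<Rightarrow> 'a \<Rightarrow> 'a::field" where
  "HL_BC n \<mu> x t s1 s2 =
     1 / (qpoch (s1 * s2) t (n - length \<mu>) * v_coeff n \<mu> t) *
     (\<Sum>w\<in>hyperoctahedral n. act w (BC_kernel n \<mu> t s1 s2) x)"

text \<open>
  The elementary symmetric function in the \<open>2n\<close> variables \<open>x\<^sub>i\<close> (tagged \<open>(i, False)\<close>) and
  \<open>1/x\<^sub>i\<close> (tagged \<open>(i, True)\<close>). The index set is empty, so the sum is 0, if \<open>r < 0\<close> or \<open>r > 2n\<close>.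
\<close>

definition e_dot :: "nat \<Rightarrow> int \<Rightarrow> (nat \<Rightarrow> 'a::field) \<Rightarrow> 'a" where
  "e_dot n r x =
     (\<Sum>S | S \<subseteq> {..<n} \<times> (UNIV :: bool set) \<and> int (card S) = r.
        \<Prod>(i, b)\<in>S. if b then inverse (x i) else x i)"

end

theory Submission
  imports Defs "HOL-Computational_Algebra.Polynomial"
begin

text \<open>
  Put \<open>s = sqrt_t\<close>. Summing over permutations cancels the normalising factor and leaves a sum
  \<open>F\<^sub>n(s)\<close> over sign changes. Replace \<open>1 + s x\<^sub>i\<close> by \<open>1 + b x\<^sub>i\<close> with a free parameter \<open>b\<close>. Partial
  fractions then give, with \<open>z = x\<^sub>n + 1/x\<^sub>n\<close>, the recursion
  \<open>F\<^sub>n(b) = (z + D) F\<^sub>n\<^sub>-\<^sub>1(b)\<close>, where \<open>(D f)(b) = (b + 1/b) f(b) - f(t b) / b\<close>. Since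
  \<open>D\<close> commutes with multiplication by functions of \<open>x\<close>, it follows that
  \<open>F\<^sub>n(b) = \<Sum>\<^sub>k \<psi>\<^sub>k(b) (e_dot (n - k) - e_dot (n - k - 2))\<close>, where \<open>\<psi>\<^sub>k = U\<^sub>k(D) 1\<close> satisfies
  \<open>D \<psi>\<^sub>k = \<psi>\<^sub>k\<^sub>+\<^sub>1 + \<psi>\<^sub>k\<^sub>-\<^sub>1\<close>. The \<open>\<psi>\<^sub>k\<close> are Carlitz's \<open>t\<close>-Fibonacci polynomials, and at \<open>b = s\<close>
  they collapse to \<open>\<psi>\<^sub>k(s) = - s\<^bsup>2k-1\<^esup> \<psi>\<^sub>k\<^sub>-\<^sub>3(s)\<close>, which produces the pentagonal exponents.
\<close>

section \<open>Lagrange interpolation\<close>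

text \<open>\<open>p\<close> equals its own interpolant, and each basis product \<open>L a\<close>
  is monic of degree \<open>card P - 1\<close>; the sum is the coefficient in that degree.\<close>

lemma sum_Lagrange_leading_coeff:
  fixes p :: "'a::field poly"
  assumes "finite P" and "degree p < card P"
  shows "(\<Sum>a\<in>P. poly p a / (\<Prod>b\<in>P - {a}. a - b)) = coeff p (card P - 1)"
proof -
  define L where "L a = (\<Prod>b\<in>P - {a}. [:- b, 1:])" for a
  define q where "q = (\<Sum>a\<in>P. smult (poly p a / (\<Prod>b\<in>P - {a}. a - b)) (L a))"
  have deg_L: "degree (L a) = card P - 1" if "a \<in> P" for a
    unfolding L_def using that assms by (subst degree_prod_eq_sum_degree) simp_all
  have coeff_L: "coeff (L a) (card P - 1) = 1" if "a \<in> P" for a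
    using lead_coeff_prod[of "\<lambda>b. [:- b, 1:]" "P - {a}"] deg_L[OF that] by (simp add: L_def)
  have "p = q"
  proof (rule poly_eqI_degree)
    fix c assume c: "c \<in> P"
    have "poly (L a) c = 0" if "a \<in> P" "a \<noteq> c" for a
      using that c assms by (auto simp: L_def poly_prod)
    then have "poly q c = (\<Sum>a\<in>P. if a = c then poly p c / (\<Prod>b\<in>P - {c}. c - b) * poly (L c) c else 0)"
      unfolding q_def poly_sum by (intro sum.cong) auto
    also have "\<dots> = poly p c"
      using c assms by (simp add: L_def poly_prod)
    finally show "poly p c = poly q c" ..
  next
    have "degree q \<le> card P - 1"
      unfolding q_def using deg_L by (intro degree_sum_le assms order_trans[OF degree_smult_le]) auto
    then show "card P > degree q"
      using assms by linarith
  qed (use assms in simp)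
  then have "coeff p (card P - 1) = coeff q (card P - 1)"
    by simp
  also have "\<dots> = (\<Sum>a\<in>P. poly p a / (\<Prod>b\<in>P - {a}. a - b))"
    by (simp add: q_def coeff_sum coeff_L[unfolded One_nat_def])
  finally show ?thesis ..
qed

text \<open>A nonzero difference has finitely many roots, but the field is infinite. This later
  frees the parameter \<open>b\<close> from its genericity conditions.\<close>

lemma poly_eqI_cofinite:
  fixes p q :: "'a::{field_char_0} poly"
  assumes "finite S" and "\<And>b. b \<notin> S \<Longrightarrow> poly p b = poly q b"
  shows "p = q"
proof (rule ccontr)
  assume "p \<noteq> q"
  then have "finite {b. poly (p - q) b = 0}"
    by (intro poly_roots_finite) simp
  moreover have "UNIV \<subseteq> S \<union> {b. poly (p - q) b = 0}"
    using assms by auto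
  ultimately show False
    using assms infinite_UNIV_char_0[where ?'a = 'a] by (meson finite_UnI finite_subset)
qed

text \<open>Interpolate the monic polynomial \<open>\<Prod>\<^sub>i (v - t y\<^sub>i)\<close> at
  \<open>0\<close> and the \<open>y\<^sub>k\<close>: the node \<open>0\<close> contributes
  \<open>t ^ card I\<close>, and each \<open>y\<^sub>k\<close> contributes \<open>1 - t\<close>
  times its product.\<close>

lemma sum_prod_t_ratio:
  fixes y :: "'i \<Rightarrow> 'a::field"
  assumes I: "finite I" and inj: "inj_on y I" and nz: "\<And>i. i \<in> I \<Longrightarrow> y i \<noteq> 0"
  shows "(1 - t) * (\<Sum>b\<in>I. \<Prod>i\<in>I - {b}. (t * y i - y b) / (y i - y b)) = 1 - t ^ card I"
proof -
  define p where "p = (\<Prod>i\<in>I. [:- t * y i, 1:])"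
  have 0: "0 \<notin> y ` I"
    using nz by auto
  have deg: "degree p = card I"
    unfolding p_def by (subst degree_prod_eq_sum_degree) simp_all
  have lead: "coeff p (card I) = 1"
    using lead_coeff_prod[of "\<lambda>i. [:- t * y i, 1:]" I] deg by (simp add: p_def)
  have card: "card (insert 0 (y ` I)) = Suc (card I)"
    using I inj 0 by (simp add: card_image)
  have "1 = (\<Sum>a\<in>insert 0 (y ` I). poly p a / (\<Prod>b\<in>insert 0 (y ` I) - {a}. a - b))"
    using sum_Lagrange_leading_coeff[of "insert 0 (y ` I)" p] I card deg lead by simp
  also have "\<dots> = poly p 0 / (\<Prod>b\<in>y ` I. 0 - b)
      + (\<Sum>a\<in>y ` I. poly p a / (\<Prod>b\<in>insert 0 (y ` I) - {a}. a - b))"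
    using I 0 by (subst sum.insert) auto
  also have "poly p 0 / (\<Prod>b\<in>y ` I. 0 - b) = (\<Prod>i\<in>I. t)"
    using nz by (simp add: p_def poly_prod prod.reindex[OF inj] prod_dividef[symmetric])
  also have "(\<Sum>a\<in>y ` I. poly p a / (\<Prod>b\<in>insert 0 (y ` I) - {a}. a - b))
      = (\<Sum>k\<in>I. (1 - t) * (\<Prod>i\<in>I - {k}. (t * y i - y k) / (y i - y k)))"
    unfolding sum.reindex[OF inj] comp_def
  proof (intro sum.cong refl)
    fix k assume k: "k \<in> I"
    have quot: "(y k - t * y i) / (y k - y i) = (t * y i - y k) / (y i - y k)" for i
      by (metis minus_diff_eq minus_divide_divide)
    have nodes: "insert 0 (y ` I) - {y k} = insert 0 (y ` (I - {k}))"
      using k nz inj by (auto simp: inj_on_def)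
    have inj': "inj_on y (I - {k})"
      using inj by (auto simp: inj_on_def)
    have "poly p (y k) = (y k - t * y k) * (\<Prod>i\<in>I - {k}. y k - t * y i)"
      using I k by (simp add: p_def poly_prod prod.remove[of I k] left_diff_distrib)
    moreover have "(\<Prod>b\<in>insert 0 (y ` I) - {y k}. y k - b) = y k * (\<Prod>i\<in>I - {k}. y k - y i)"
      unfolding nodes using I 0 by (subst prod.insert) (auto simp: prod.reindex[OF inj'])
    ultimately have "poly p (y k) / (\<Prod>b\<in>insert 0 (y ` I) - {y k}. y k - b)
        = (y k - t * y k) / y k * (\<Prod>i\<in>I - {k}. (y k - t * y i) / (y k - y i))"
      by (simp add: prod_dividef)
    moreover have "(y k - t * y k) / y k = 1 - t"
      using nz[OF k] by (simp add: diff_divide_distrib)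
    ultimately show "poly p (y k) / (\<Prod>b\<in>insert 0 (y ` I) - {y k}. y k - b)
        = (1 - t) * (\<Prod>i\<in>I - {k}. (t * y i - y k) / (y i - y k))"
      by (simp only: quot)
  qed
  finally show ?thesis
    by (simp add: sum_distrib_left algebra_simps)
qed

text \<open>The monic polynomial \<open>v ^ 2 * N v I\<close> has degree one less than the number of
  nodes, so its Lagrange sum is 1. The factor \<open>v ^ 2\<close> makes up for the three extra
  nodes.\<close>

lemma partial_fraction_at_nodes:
  fixes y :: "'i \<Rightarrow> 'a::field" and t :: 'a
  defines "N \<equiv> \<lambda>v I. \<Prod>i\<in>I. v - t * y i"
  assumes I: "finite I" and inj: "inj_on y I"
    and nodes: "u \<notin> y ` I" "v \<notin> y ` I" "w \<notin> y ` I" "u \<noteq> v" "u \<noteq> w" "v \<noteq> w"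
  shows "u ^ 2 * N u I / ((u - v) * (u - w) * (\<Prod>i\<in>I. u - y i))
    + v ^ 2 * N v I / ((v - u) * (v - w) * (\<Prod>i\<in>I. v - y i))
    + w ^ 2 * N w I / ((w - u) * (w - v) * (\<Prod>i\<in>I. w - y i))
    + (\<Sum>k\<in>I. y k ^ 2 * N (y k) I
        / ((y k - u) * (y k - v) * (y k - w) * (\<Prod>i\<in>I - {k}. y k - y i))) = 1"
proof -
  define p where "p = [:0, 0, 1:] * (\<Prod>i\<in>I. [:- t * y i, 1:])"
  let ?P = "insert u (insert v (insert w (y ` I)))"
  have deg_prod: "degree (\<Prod>i\<in>I. [:- t * y i, 1:]) = card I"
    by (subst degree_prod_eq_sum_degree) simp_all
  have nz: "(\<Prod>i\<in>I. [:- t * y i, 1:]) \<noteq> 0"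
    using I by simp
  have deg: "degree p = card I + 2"
    unfolding p_def using deg_prod nz by (subst degree_mult_eq) simp_all
  have "lead_coeff p = 1"
    unfolding p_def lead_coeff_mult lead_coeff_prod by simp
  then have lead: "coeff p (card I + 2) = 1"
    by (simp add: deg)
  have poly_p: "poly p a = a ^ 2 * N a I" for a
    by (simp add: p_def N_def poly_prod power2_eq_square)
  have card: "card ?P = card I + 3"
    using I inj nodes by (simp add: card_image)
  have "1 = (\<Sum>a\<in>?P. poly p a / (\<Prod>b\<in>?P - {a}. a - b))"
    using sum_Lagrange_leading_coeff[of ?P p] I card deg lead by simp
  also have "\<dots> = poly p u / (\<Prod>b\<in>?P - {u}. u - b) + poly p v / (\<Prod>b\<in>?P - {v}. v - b)
      + poly p w / (\<Prod>b\<in>?P - {w}. w - b) + (\<Sum>a\<in>y ` I. poly p a / (\<Prod>b\<in>?P - {a}. a - b))"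
    using I nodes by (simp add: add.assoc)
  also have "?P - {u} = insert v (insert w (y ` I))"
    using nodes by auto
  also have "?P - {v} = insert u (insert w (y ` I))"
    using nodes by auto
  also have "?P - {w} = insert u (insert v (y ` I))"
    using nodes by auto
  also have "(\<Sum>a\<in>y ` I. poly p a / (\<Prod>b\<in>?P - {a}. a - b))
      = (\<Sum>k\<in>I. y k ^ 2 * N (y k) I
        / ((y k - u) * (y k - v) * (y k - w) * (\<Prod>i\<in>I - {k}. y k - y i)))"
    unfolding sum.reindex[OF inj] comp_def poly_p
  proof (intro sum.cong refl arg_cong2[where f = "(/)"])
    fix k assume k: "k \<in> I"
    have P: "?P - {y k} = insert u (insert v (insert w (y ` (I - {k}))))"
      using k nodes inj by (auto simp: inj_on_def)
    have inj': "inj_on y (I - {k})"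
      using inj by (auto simp: inj_on_def)
    have "u \<notin> y ` (I - {k})" "v \<notin> y ` (I - {k})" "w \<notin> y ` (I - {k})"
      using nodes by auto
    then show "(\<Prod>b\<in>?P - {y k}. y k - b)
        = (y k - u) * (y k - v) * (y k - w) * (\<Prod>i\<in>I - {k}. y k - y i)"
      unfolding P using I nodes by (simp add: prod.reindex[OF inj'] mult.assoc)
  qed
  finally show ?thesis
    using I nodes by (simp add: poly_p prod.reindex[OF inj] mult.assoc)
qed

section \<open>The t-Fibonacci polynomials\<close>

text \<open>
  The recursion runs over half steps \<open>a \<mapsto> s a\<close> of the substitution \<open>a \<mapsto> t a\<close>, which avoids the
  division by \<open>a\<close> in the defining recursion \<open>\<psi>\<^sub>k\<^sub>+\<^sub>1 = D \<psi>\<^sub>k - \<psi>\<^sub>k\<^sub>-\<^sub>1\<close>.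
\<close>

fun psi :: "'a::comm_ring_1 \<Rightarrow> nat \<Rightarrow> 'a \<Rightarrow> 'a" where
  "psi s 0 a = 1"
| "psi s (Suc 0) a = a"
| "psi s (Suc (Suc k)) a = a * psi s (Suc k) a - s ^ (k + 2) * psi s k (s * a)"

text \<open>A companion recursion: the definition shifts the argument of the lowest term, this one
  that of the top term. Together they eliminate half steps.\<close>

lemma psi_scale: "psi s (Suc (Suc k)) (s * a) = s ^ (k + 2) * (a * psi s (Suc k) a - psi s k a)"
proof (induction k arbitrary: a rule: less_induct)
  case (less k)
  show ?case
  proof (cases k)
    case 0
    then show ?thesis by (simp add: algebra_simps power2_eq_square)
  next
    case (Suc m)
    show ?thesis
    proof (cases m)
      case 0
      then show ?thesis using Suc by (simp add: algebra_simps power2_eq_square power3_eq_cube)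
    next
      case m: (Suc l)
      \<comment> \<open>The induction hypothesis enters one index lower at \<open>a\<close> and two
        lower at \<open>s * a\<close>; the leftover half-step values are removed by the defining
        recursion.\<close>
      have 1: "psi s (Suc (Suc m)) (s * a) = s ^ (m + 2) * (a * psi s (Suc m) a - psi s m a)"
        using less[of m a] Suc by simp
      have 2: "psi s (Suc (Suc l)) (s * (s * a)) = s ^ (l + 2) * (s * a * psi s (Suc l) (s * a) - psi s l (s * a))"
        using less[of l "s * a"] Suc m by simp
      have 3: "s ^ (l + 2) * psi s l (s * a) = a * psi s (Suc l) a - psi s (Suc (Suc l)) a"
        by simp
      have 4: "s ^ (m + 2) * psi s m (s * a) = a * psi s (Suc m) a - psi s (Suc (Suc m)) a"
        by simp
      have "psi s (Suc (Suc k)) (s * a) = s * a * psi s (Suc (Suc m)) (s * a) - s ^ (m + 3) * psi s (Suc m) (s * (s * a))"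
        using Suc by (simp add: numeral_3_eq_3)
      also have "psi s (Suc m) (s * (s * a)) = a * (s ^ (m + 2) * psi s m (s * a)) - s ^ (l + 2) * psi s l (s * a)"
        using 2 m by (simp add: algebra_simps power2_eq_square)
      also have "\<dots> = a * (a * psi s (Suc m) a - psi s (Suc (Suc m)) a) - (a * psi s m a - psi s (Suc m) a)"
        unfolding 3 4 using m by simp
      finally show ?thesis
        unfolding 1 using Suc by (simp add: algebra_simps power2_eq_square numeral_3_eq_3 del: psi.simps(3))
    qed
  qed
qed

text \<open>This is \<open>D \<psi>\<^sub>k\<^sub>+\<^sub>1 = \<psi>\<^sub>k\<^sub>+\<^sub>2 +
  \<psi>\<^sub>k\<close> multiplied by \<open>a\<close>. The full step \<open>t * a\<close> is two
  half steps: \<open>psi_scale\<close> undoes the outer one, the defining recursion the inner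
  one.\<close>

lemma psi_three_term:
  assumes "t = s ^ 2"
  shows "a * (psi s (Suc (Suc k)) a + psi s k a) = (a ^ 2 + 1) * psi s (Suc k) a - psi s (Suc k) (t * a)"
proof (cases k)
  case 0
  then show ?thesis using assms by (simp add: algebra_simps power2_eq_square)
next
  case (Suc m)
  have 1: "s ^ (m + 2) * psi s m (s * a) = a * psi s (Suc m) a - psi s (Suc (Suc m)) a"
    by simp
  have 2: "s ^ (k + 2) * psi s k (s * a) = a * psi s (Suc k) a - psi s (Suc (Suc k)) a"
    by simp
  have "psi s (Suc k) (t * a) = a * (s ^ (k + 2) * psi s k (s * a)) - s ^ (m + 2) * psi s m (s * a)"
    using psi_scale[of s m "s * a"] assms Suc by (simp add: algebra_simps power2_eq_square)
  then show ?thesis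
    unfolding 1 2 using Suc by (simp add: algebra_simps power2_eq_square del: psi.simps(3))
qed

text \<open>At \<open>a = 1\<close>, \<open>psi_scale\<close> gives a difference of neighbouring
  values at 1, and the defining recursion turns that difference back into a value at
  \<open>s\<close>.\<close>

lemma psi_shift3: "psi s (k + 3) s = - (s ^ (2 * k + 5)) * psi s k s"
proof -
  have "2 * k + 5 = (Suc k + 2) + (k + 2)"
    by simp
  then have exps: "s ^ (2 * k + 5) = s ^ (Suc k + 2) * s ^ (k + 2)"
    by (simp only: power_add)
  have idx: "k + 3 = Suc (Suc (Suc k))"
    by simp
  have "psi s (k + 3) s = s ^ (Suc k + 2) * (psi s (Suc (Suc k)) 1 - psi s (Suc k) 1)"
    using psi_scale[of s "Suc k" 1] by (simp only: idx mult_1_left mult_1_right)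
  also have "psi s (Suc (Suc k)) 1 - psi s (Suc k) 1 = - (s ^ (k + 2) * psi s k s)"
    by simp
  finally show ?thesis
    unfolding exps by (simp only: mult_minus_left mult_minus_right mult.assoc)
qed

text \<open>The starting values at \<open>s\<close> are \<open>1\<close>, \<open>s\<close> and
  \<open>s ^ 2 - s ^ 2 = 0\<close>. \<open>psi_shift3\<close> propagates them within each residue
  class modulo 3, and its linear exponents add up to quadratic ones.\<close>

lemma psi_at_s:
  shows "psi s (3 * j) s = (-1) ^ j * s ^ (3 * j ^ 2 + 2 * j)" (is ?A)
    and "psi s (3 * j + 1) s = (-1) ^ j * s ^ (3 * j ^ 2 + 4 * j + 1)" (is ?B)
    and "psi s (3 * j + 2) s = 0" (is ?C)
proof -
  have "?A \<and> ?B \<and> ?C"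
  proof (induction j)
    case 0
    then show ?case by (simp add: power2_eq_square numeral_2_eq_2)
  next
    case (Suc j)
    have idx: "3 * Suc j = 3 * j + 3" "3 * Suc j + 1 = (3 * j + 1) + 3" "3 * Suc j + 2 = (3 * j + 2) + 3"
      by simp_all
    have "3 * Suc j ^ 2 + 2 * Suc j = (2 * (3 * j) + 5) + (3 * j ^ 2 + 2 * j)"
      "3 * Suc j ^ 2 + 4 * Suc j + 1 = (2 * (3 * j + 1) + 5) + (3 * j ^ 2 + 4 * j + 1)"
      by (simp_all add: power2_eq_square)
    then have exps: "s ^ (3 * Suc j ^ 2 + 2 * Suc j) = s ^ (2 * (3 * j) + 5) * s ^ (3 * j ^ 2 + 2 * j)"
      "s ^ (3 * Suc j ^ 2 + 4 * Suc j + 1) = s ^ (2 * (3 * j + 1) + 5) * s ^ (3 * j ^ 2 + 4 * j + 1)"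
      by (simp_all only: power_add)
    show ?case
      unfolding idx(2,3) exps unfolding idx(1) psi_shift3 using Suc by (simp only: power_Suc) simp
  qed
  then show ?A ?B ?C by blast+
qed

lemma psi_poly: "\<exists>p. \<forall>a. psi s k a = poly p a"
proof (induction k rule: less_induct)
  case (less k)
  consider "k = 0" | "k = 1" | l where "k = Suc (Suc l)"
    by (metis One_nat_def old.nat.exhaust)
  then show ?case
  proof cases
    case 1
    then show ?thesis by (intro exI[of _ 1]) simp
  next
    case 2
    then show ?thesis by (intro exI[of _ "[:0, 1:]"]) simp
  next
    case 3
    obtain p q where p: "\<And>a. psi s (Suc l) a = poly p a" and q: "\<And>a. psi s l a = poly q a"
      using less[of "Suc l"] less[of l] 3 by auto
    show ?thesis
      unfolding 3
      by (intro exI[of _ "[:0, 1:] * p - smult (s ^ (l + 2)) (q \<circ>\<^sub>p [:0, s:])"])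
        (simp add: p q poly_pcompose mult.commute)
  qed
qed

section \<open>Symmetric elementary functions\<close>

lemma sum_Pow_insert:
  assumes "finite I" "k \<notin> I"
  shows "(\<Sum>A\<in>Pow (insert k I). f A) = (\<Sum>A\<in>Pow I. f A + f (insert k A))"
proof -
  have "inj_on (insert k) (Pow I)"
    using assms by (auto simp: inj_on_def)
  then show ?thesis
    unfolding Pow_insert using assms
    by (subst sum.union_disjoint) (auto simp: sum.reindex sum.distrib)
qed

lemma e_dot_0: "e_dot 0 r x = (if r = 0 then 1 else 0)"
  by (auto simp: e_dot_def Collect_conv_if)

text \<open>The two new variables have product 1, so they multiply the generating function in
  \<open>q\<close> by \<open>1 + (x n + inverse (x n)) q + q ^ 2\<close>.\<close>

lemma e_dot_Suc:
  assumes "x n \<noteq> 0"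
  shows "e_dot (Suc n) r x = e_dot n r x + (x n + inverse (x n)) * e_dot n (r - 1) x + e_dot n (r - 2) x"
proof -
  define B where "B = {..<n} \<times> (UNIV :: bool set)"
  define m where "m = (\<lambda>(i, b). if b then inverse (x i) else x i)"
  define c where "c = (\<lambda>S (r::int). if int (card S) = r then prod m S else 0)"
  have fin: "finite B"
    by (simp add: B_def)
  have e: "e_dot n r x = (\<Sum>S\<in>Pow B. c S r)" for r
    unfolding e_dot_def c_def m_def B_def
    by (subst sum.inter_filter[symmetric]) (auto intro!: sum.cong)
  have B': "{..<Suc n} \<times> (UNIV :: bool set) = insert (n, True) (insert (n, False) B)"
    by (auto simp: B_def)
  have "e_dot (Suc n) r x = (\<Sum>S\<in>Pow (insert (n, True) (insert (n, False) B)). c S r)"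
    unfolding e_dot_def c_def m_def B'[symmetric]
    by (subst sum.inter_filter[symmetric]) (auto intro!: sum.cong)
  also have "\<dots> = (\<Sum>S\<in>Pow B. c S r + c (insert (n, False) S) r
      + (c (insert (n, True) S) r + c (insert (n, True) (insert (n, False) S)) r))"
    using fin by (subst sum_Pow_insert, simp, simp add: B_def, subst sum_Pow_insert) (simp_all add: B_def sum.distrib sum_Pow_insert)
  also have "\<dots> = (\<Sum>S\<in>Pow B. c S r + (x n + inverse (x n)) * c S (r - 1) + c S (r - 2))"
  proof (intro sum.cong refl)
    fix S assume "S \<in> Pow B"
    then have S: "finite S" "(n, True) \<notin> S" "(n, False) \<notin> S"
      using finite_subset[OF _ fin] by (auto simp: B_def)
    show "c S r + c (insert (n, False) S) r
      + (c (insert (n, True) S) r + c (insert (n, True) (insert (n, False) S)) r)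
      = c S r + (x n + inverse (x n)) * c S (r - 1) + c S (r - 2)"
      using S assms by (auto simp: c_def m_def algebra_simps)
  qed
  finally show ?thesis
    by (simp add: e sum.distrib sum_distrib_left)
qed

text \<open>The coefficients in \<open>e_dot_Suc\<close> are palindromic, so symmetry about degree
  \<open>n\<close> becomes symmetry about \<open>n + 1\<close>.\<close>

lemma e_dot_symmetric:
  assumes "\<And>i. i < n \<Longrightarrow> x i \<noteq> 0"
  shows "e_dot n (int n + r) x = e_dot n (int n - r) x"
  using assms
proof (induction n arbitrary: r)
  case 0
  then show ?case by (simp add: e_dot_0)
next
  case (Suc n)
  have IH: "e_dot n (int n + r) x = e_dot n (int n - r) x" for r
    using Suc by simp
  have "e_dot n (1 + int n + r) x = e_dot n (int n - r - 1) x"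
    using IH[of "r + 1"] by (simp add: algebra_simps)
  moreover have "e_dot n (int n + r - 1) x = e_dot n (1 + int n - r) x"
    using IH[of "r - 1"] by (simp add: algebra_simps)
  ultimately show ?case
    using IH[of r] Suc.prems by (simp add: e_dot_Suc algebra_simps)
qed

lemma e_dot_negative: "r < 0 \<Longrightarrow> e_dot n r x = 0"
  unfolding e_dot_def by (rule sum.neutral) auto

section \<open>Reduction to a sum over sign changes\<close>

text \<open>Arbitrary index sets are allowed so that any index can be split off, not only the
  largest. The order merely lists each pair once; for symmetric \<open>f\<close> it does not affect
  the value.\<close>

definition pair_prod :: "(nat \<Rightarrow> nat \<Rightarrow> 'a::comm_monoid_mult) \<Rightarrow> nat set \<Rightarrow> 'a" where
  "pair_prod f I = (\<Prod>j\<in>I. \<Prod>i | i \<in> I \<and> i < j. f i j)"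

lemma pair_prod_empty [simp]: "pair_prod f {} = 1"
  by (simp add: pair_prod_def)

lemma pair_prod_lessThan: "pair_prod f {..<n} = (\<Prod>j<n. \<Prod>i<j. f i j)"
  unfolding pair_prod_def by (intro prod.cong) auto

lemma pair_prod_cong:
  assumes "\<And>i j. i \<in> I \<Longrightarrow> j \<in> I \<Longrightarrow> i \<noteq> j \<Longrightarrow> f i j = g i j"
  shows "pair_prod f I = pair_prod g I"
  unfolding pair_prod_def using assms by (intro prod.cong) auto

text \<open>Pairs with \<open>i < k\<close> sit in the factor for \<open>k\<close>, and pairs with
  \<open>k < j\<close> in the factors for the larger \<open>j\<close>; symmetry of \<open>f\<close>
  merges the two.\<close>

lemma pair_prod_insert:
  assumes "finite I" "k \<notin> I" and sym: "\<And>i j. f i j = f j i"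
  shows "pair_prod f (insert k I) = (\<Prod>i\<in>I. f i k) * pair_prod f I"
proof -
  have below: "{i. i \<in> insert k I \<and> i < k} = {i \<in> I. i < k}"
    by auto
  have "(\<Prod>i | i \<in> insert k I \<and> i < j. f i j)
      = (if k < j then f k j else 1) * (\<Prod>i | i \<in> I \<and> i < j. f i j)" for j
  proof (cases "k < j")
    case True
    then have "{i. i \<in> insert k I \<and> i < j} = insert k {i. i \<in> I \<and> i < j}"
      by auto
    then show ?thesis
      using assms True by simp
  next
    case False
    then have "{i. i \<in> insert k I \<and> i < j} = {i. i \<in> I \<and> i < j}"
      by auto
    then show ?thesis
      using False by simp
  qed
  then have "pair_prod f (insert k I)
      = (\<Prod>i | i \<in> I \<and> i < k. f i k) * ((\<Prod>j\<in>I. if k < j then f k j else 1) * pair_prod f I)"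
    unfolding pair_prod_def using assms(1,2) below by (simp add: prod.distrib ac_simps)
  also have "\<dots> = (\<Prod>j\<in>I. (if j < k then f j k else 1) * (if k < j then f k j else 1)) * pair_prod f I"
    using assms(1) by (simp add: prod.inter_filter prod.distrib mult.assoc)
  also have "(\<Prod>j\<in>I. (if j < k then f j k else 1) * (if k < j then f k j else 1)) = (\<Prod>j\<in>I. f j k)"
    using assms(2) sym by (intro prod.cong refl) (auto simp: not_less)
  finally show ?thesis .
qed

lemma pair_prod_reindex:
  assumes "finite I" "inj_on \<sigma> I" and sym: "\<And>i j. f i j = f j i"
  shows "pair_prod (\<lambda>i j. f (\<sigma> i) (\<sigma> j)) I = pair_prod f (\<sigma> ` I)"
  using assms(1,2)
proof (induction I rule: finite_induct)
  case empty
  then show ?case by simp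
next
  case (insert k I)
  then have "pair_prod (\<lambda>i j. f (\<sigma> i) (\<sigma> j)) (insert k I) = (\<Prod>i\<in>I. f (\<sigma> i) (\<sigma> k)) * pair_prod f (\<sigma> ` I)"
    by (subst pair_prod_insert) (auto intro: sym)
  also have "\<dots> = pair_prod f (\<sigma> ` insert k I)"
    using insert by (simp add: pair_prod_insert[OF _ _ sym] prod.reindex)
  finally show ?case .
qed

section \<open>The sum over permutations\<close>

text \<open>Induction on \<open>n\<close>, splitting by the image \<open>b\<close> of the last
  index: the factors with that index depend only on \<open>b\<close>, and
  \<open>sum_prod_t_ratio\<close> sums them to \<open>(1 - t ^ Suc n) / (1 - t)\<close>.\<close>

lemma sum_permutations_t_ratio:
  fixes y :: "nat \<Rightarrow> 'a::field"
  assumes "inj_on y {..<n}" "\<And>i. i < n \<Longrightarrow> y i \<noteq> 0" "t \<noteq> 1"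
  shows "(\<Sum>\<sigma> | \<sigma> permutes {..<n}. \<Prod>j<n. \<Prod>i<j. (t * y (\<sigma> i) - y (\<sigma> j)) / (y (\<sigma> i) - y (\<sigma> j)))
    = qpoch t t n / (1 - t) ^ n"
  using assms(1,2)
proof (induction n arbitrary: y)
  case 0
  then show ?case by (simp add: qpoch_def)
next
  case (Suc n)
  define r where "r y i j = (t * y i - y j) / (y i - y j)" for y :: "nat \<Rightarrow> 'a" and i j
  \<comment> \<open>Permutations sending \<open>n\<close> to \<open>b\<close> are
    \<open>transpose n b \<circ> q\<close> with \<open>q\<close> fixing \<open>n\<close>; the
    remaining product falls under the induction hypothesis for relabelled variables.\<close>
  have inner: "(\<Sum>q | q permutes {..<n}. \<Prod>j<Suc n. \<Prod>i<j. r y ((transpose n b \<circ> q) i) ((transpose n b \<circ> q) j))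
      = qpoch t t n / (1 - t) ^ n * (\<Prod>i\<in>{..<Suc n} - {b}. r y i b)" if b: "b < Suc n" for b
  proof -
    have perm: "transpose n b permutes {..<Suc n}"
      using b by (intro permutes_swap_id) auto
    have img: "transpose n b ` {..<n} = {..<Suc n} - {b}"
    proof -
      have "{..<n} = {..<Suc n} - {n}" by auto
      then show ?thesis
        using inj_on_image_set_diff[of "transpose n b" UNIV "{..<Suc n}" "{n}"] permutes_image[OF perm] by simp
    qed
    have inj: "inj_on (transpose n b) {..<n}"
      by simp
    have "(\<Prod>j<Suc n. \<Prod>i<j. r y ((transpose n b \<circ> q) i) ((transpose n b \<circ> q) j))
        = (\<Prod>j<n. \<Prod>i<j. r (y \<circ> transpose n b) (q i) (q j)) * (\<Prod>i\<in>{..<Suc n} - {b}. r y i b)"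
      if q: "q permutes {..<n}" for q
    proof -
      have "q n = n"
        using q by (simp add: permutes_not_in)
      then have "(\<Prod>i<n. r y ((transpose n b \<circ> q) i) ((transpose n b \<circ> q) n))
          = (\<Prod>i<n. ((\<lambda>i. r y (transpose n b i) b) \<circ> q) i)"
        by simp
      also have "\<dots> = (\<Prod>i<n. r y (transpose n b i) b)"
        by (subst prod.permute[OF q]) (simp add: comp_def)
      also have "\<dots> = (\<Prod>i\<in>{..<Suc n} - {b}. r y i b)"
        unfolding img[symmetric] by (simp add: prod.reindex[OF inj])
      finally show ?thesis
        by (simp add: r_def)
    qed
    then have "(\<Sum>q | q permutes {..<n}. \<Prod>j<Suc n. \<Prod>i<j. r y ((transpose n b \<circ> q) i) ((transpose n b \<circ> q) j))
        = (\<Sum>q | q permutes {..<n}. \<Prod>j<n. \<Prod>i<j. r (y \<circ> transpose n b) (q i) (q j))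
          * (\<Prod>i\<in>{..<Suc n} - {b}. r y i b)"
      by (simp add: sum_distrib_right)
    also have "(\<Sum>q | q permutes {..<n}. \<Prod>j<n. \<Prod>i<j. r (y \<circ> transpose n b) (q i) (q j))
        = qpoch t t n / (1 - t) ^ n"
      unfolding r_def
    proof (rule Suc.IH)
      show "inj_on (y \<circ> transpose n b) {..<n}"
        using Suc.prems(1) img by (intro comp_inj_on inj) (auto elim: inj_on_subset)
      show "(y \<circ> transpose n b) i \<noteq> 0" if "i < n" for i
        using Suc.prems(2)[of "transpose n b i"] img that by auto
    qed
    finally show ?thesis .
  qed
  have "(\<Sum>\<sigma> | \<sigma> permutes {..<Suc n}. \<Prod>j<Suc n. \<Prod>i<j. r y (\<sigma> i) (\<sigma> j))
      = (\<Sum>b<Suc n. \<Sum>q | q permutes {..<n}. \<Prod>j<Suc n. \<Prod>i<j. r y ((transpose n b \<circ> q) i) ((transpose n b \<circ> q) j))"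
    unfolding lessThan_Suc[of n] by (rule sum_over_permutations_insert) auto
  also have "\<dots> = qpoch t t n / (1 - t) ^ n * (\<Sum>b<Suc n. \<Prod>i\<in>{..<Suc n} - {b}. r y i b)"
    using inner by (simp add: sum_distrib_left del: sum.lessThan_Suc prod.lessThan_Suc)
  also have "(\<Sum>b<Suc n. \<Prod>i\<in>{..<Suc n} - {b}. r y i b) = (1 - t ^ Suc n) / (1 - t)"
    using sum_prod_t_ratio[of "{..<Suc n}" y t] Suc.prems assms(3)
    by (simp add: r_def nonzero_eq_divide_eq mult.commute del: sum.lessThan_Suc)
  finally show ?case
    by (simp add: r_def qpoch_def)
qed

section \<open>Sign changes and removal of the normalising factor\<close>

definition signed :: "(nat \<Rightarrow> 'a::field) \<Rightarrow> nat set \<Rightarrow> nat \<Rightarrow> 'a" where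
  "signed x A i = (if i \<in> A then inverse (x i) else x i)"

definition generic :: "nat \<Rightarrow> (nat \<Rightarrow> 'a::field) \<Rightarrow> bool" where
  "generic n x \<longleftrightarrow> (\<forall>i<n. x i \<noteq> 0 \<and> x i ^ 2 \<noteq> 1) \<and>
     (\<forall>i<n. \<forall>j<n. i \<noteq> j \<longrightarrow> x i \<noteq> x j \<and> x i * x j \<noteq> 1)"

lemma generic_signed:
  assumes "generic n x"
  shows "generic n (signed x A)"
proof -
  have "signed x A i \<noteq> 0 \<and> signed x A i ^ 2 \<noteq> 1" if "i < n" for i
    using assms that by (auto simp: generic_def signed_def power_inverse)
  moreover have "signed x A i \<noteq> signed x A j \<and> signed x A i * signed x A j \<noteq> 1"
    if "i < n" "j < n" "i \<noteq> j" for i j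
  proof -
    have "x i \<noteq> 0" "x j \<noteq> 0" "x i \<noteq> x j" "x i * x j \<noteq> 1"
      using assms that by (auto simp: generic_def)
    then show ?thesis
      by (auto simp: signed_def field_simps)
  qed
  ultimately show ?thesis
    by (simp add: generic_def)
qed

text \<open>The permutation-invariant part of the kernel for the column
  \<open>replicate n 1\<close>, without the factors that carry \<open>s1\<close>.\<close>

definition core :: "nat \<Rightarrow> 'a \<Rightarrow> (nat \<Rightarrow> 'a::field) \<Rightarrow> 'a" where
  "core n t y = (\<Prod>i<n. 1 / (y i * (1 - y i ^ 2))) *
     pair_prod (\<lambda>i j. (1 - t * y i * y j) / (1 - y i * y j)) {..<n}"

text \<open>This is \<open>F\<^sub>n(b)\<close> of the overview; \<open>b\<close> stays free because
  the recursion in \<open>n\<close> also evaluates at \<open>t * b\<close>.\<close>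

definition sign_sum :: "nat \<Rightarrow> (nat \<Rightarrow> 'a) \<Rightarrow> 'a \<Rightarrow> 'a \<Rightarrow> 'a::field" where
  "sign_sum n x t b = (\<Sum>A\<in>Pow {..<n}. core n t (signed x A) * (\<Prod>i<n. 1 + b * signed x A i))"

text \<open>The kernel is a permutation-invariant part times a product of ratios whose sum over
  permutations is the same for every choice of signs. That constant is \<open>v_coeff\<close>, and
  the other \<open>qpoch\<close> factor has length 0.\<close>

lemma HL_BC_column:
  fixes x :: "nat \<Rightarrow> 'a::field"
  assumes n: "n \<ge> 1" and t: "\<And>k. 1 \<le> k \<Longrightarrow> k \<le> n \<Longrightarrow> t ^ k \<noteq> 1" and gen: "generic n x"
  shows "HL_BC n (replicate n 1) x t (- s) 0 = sign_sum n x t s"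
proof -
  define r where "r y i j = (t * y i - y j) / (y i - y j)" for y :: "nat \<Rightarrow> 'a" and i j
  let ?K = "BC_kernel n (replicate n 1) t (- s) 0"
  have t1: "t \<noteq> 1"
    using t[of 1] n by auto
  have K: "?K (\<lambda>i. y (\<sigma> i))
      = core n t y * (\<Prod>i<n. 1 + s * y i) * (\<Prod>j<n. \<Prod>i<j. r y (\<sigma> i) (\<sigma> j))"
    if \<sigma>: "\<sigma> permutes {..<n}" for y \<sigma>
  proof -
    let ?f = "\<lambda>i j. (1 - t * y i * y j) / (1 - y i * y j)"
    have "(\<Prod>i<n. y (\<sigma> i) powi (- int (part (replicate n 1) i))
          * ((1 - (- s) * y (\<sigma> i)) * (1 - 0 * y (\<sigma> i)) / (1 - y (\<sigma> i) ^ 2)))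
        = (\<Prod>i<n. ((\<lambda>i. 1 / (y i * (1 - y i ^ 2)) * (1 + s * y i)) \<circ> \<sigma>) i)"
      by (intro prod.cong refl) (simp add: part_def power_int_minus field_simps)
    also have "\<dots> = (\<Prod>i<n. 1 / (y i * (1 - y i ^ 2)) * (1 + s * y i))"
      by (subst prod.permute[OF \<sigma>]) (simp add: comp_def)
    finally have 1: "(\<Prod>i<n. y (\<sigma> i) powi (- int (part (replicate n 1) i))
          * ((1 - (- s) * y (\<sigma> i)) * (1 - 0 * y (\<sigma> i)) / (1 - y (\<sigma> i) ^ 2)))
        = (\<Prod>i<n. 1 / (y i * (1 - y i ^ 2))) * (\<Prod>i<n. 1 + s * y i)"
      by (simp only: prod.distrib)
    have "(\<Prod>j<n. \<Prod>i<j. (t * y (\<sigma> i) - y (\<sigma> j)) * (1 - t * y (\<sigma> i) * y (\<sigma> j))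
          / ((y (\<sigma> i) - y (\<sigma> j)) * (1 - y (\<sigma> i) * y (\<sigma> j))))
        = (\<Prod>j<n. \<Prod>i<j. r y (\<sigma> i) (\<sigma> j)) * pair_prod (\<lambda>i j. ?f (\<sigma> i) (\<sigma> j)) {..<n}"
      by (simp add: pair_prod_lessThan r_def flip: prod.distrib)
    also have "pair_prod (\<lambda>i j. ?f (\<sigma> i) (\<sigma> j)) {..<n} = pair_prod ?f (\<sigma> ` {..<n})"
      using \<sigma> by (intro pair_prod_reindex) (auto simp: mult.commute mult.assoc intro: permutes_inj_on)
    also have "\<sigma> ` {..<n} = {..<n}"
      using \<sigma> by (rule permutes_image)
    finally show ?thesis
      unfolding BC_kernel_def 1 core_def by (simp only: ac_simps)
  qed
  have act: "(\<Sum>A\<in>Pow {..<n}. act (\<sigma>, A) ?K x)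
      = (\<Sum>A\<in>Pow {..<n}. core n t (signed x A) * (\<Prod>i<n. 1 + s * signed x A i)
          * (\<Prod>j<n. \<Prod>i<j. r (signed x A) (\<sigma> i) (\<sigma> j)))"
    if \<sigma>: "\<sigma> permutes {..<n}" for \<sigma>
  proof -
    have inj: "inj \<sigma>"
      using \<sigma> by (rule permutes_inj)
    \<comment> \<open>\<open>act\<close> inverts by position but \<open>signed\<close> by variable,
      so \<open>A\<close> is replaced by its image under \<open>\<sigma>\<close>, which again runs
      over all subsets.\<close>
    have "(\<lambda>i. if i \<in> A then inverse (x (\<sigma> i)) else x (\<sigma> i)) = (\<lambda>i. signed x (\<sigma> ` A) (\<sigma> i))" for A
      using inj by (auto simp: signed_def inj_image_mem_iff)
    then have "(\<Sum>A\<in>Pow {..<n}. act (\<sigma>, A) ?K x) = (\<Sum>A\<in>Pow {..<n}. ?K (\<lambda>i. signed x (\<sigma> ` A) (\<sigma> i)))"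
      by (simp only: act_def fst_conv snd_conv)
    also have "\<dots> = (\<Sum>A\<in>Pow {..<n}. ?K (\<lambda>i. signed x A (\<sigma> i)))"
      using sum.reindex_bij_betw[OF bij_betw_image_Pow[OF permutes_imp_bij[OF \<sigma>]]] by simp
    finally show ?thesis
      unfolding K[OF \<sigma>] .
  qed
  have "(\<Sum>w\<in>hyperoctahedral n. act w ?K x)
      = (\<Sum>\<sigma> | \<sigma> permutes {..<n}. \<Sum>A\<in>Pow {..<n}. act (\<sigma>, A) ?K x)"
    by (simp add: hyperoctahedral_def sum.cartesian_product)
  also have "\<dots> = (\<Sum>\<sigma> | \<sigma> permutes {..<n}.
      \<Sum>A\<in>Pow {..<n}. core n t (signed x A) * (\<Prod>i<n. 1 + s * signed x A i)
          * (\<Prod>j<n. \<Prod>i<j. r (signed x A) (\<sigma> i) (\<sigma> j)))"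
    by (rule sum.cong[OF refl]) (rule act, simp)
  also have "\<dots> = (\<Sum>A\<in>Pow {..<n}. core n t (signed x A) * (\<Prod>i<n. 1 + s * signed x A i)
      * (\<Sum>\<sigma> | \<sigma> permutes {..<n}. \<Prod>j<n. \<Prod>i<j. r (signed x A) (\<sigma> i) (\<sigma> j)))"
    by (subst sum.swap) (simp only: sum_distrib_left)
  also have "\<dots> = (\<Sum>A\<in>Pow {..<n}. core n t (signed x A) * (\<Prod>i<n. 1 + s * signed x A i)
      * (qpoch t t n / (1 - t) ^ n))"
  proof (intro sum.cong refl arg_cong2[where f = "(*)"])
    fix A
    have "generic n (signed x A)"
      using gen by (rule generic_signed)
    then show "(\<Sum>\<sigma> | \<sigma> permutes {..<n}. \<Prod>j<n. \<Prod>i<j. r (signed x A) (\<sigma> i) (\<sigma> j)) = qpoch t t n / (1 - t) ^ n"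
      unfolding r_def using t1 by (intro sum_permutations_t_ratio) (auto simp: inj_on_def generic_def)
  qed
  also have "\<dots> = sign_sum n x t s * (qpoch t t n / (1 - t) ^ n)"
    by (simp only: sign_sum_def sum_distrib_right)
  finally have sum: "(\<Sum>w\<in>hyperoctahedral n. act w ?K x) = sign_sum n x t s * (qpoch t t n / (1 - t) ^ n)" .
  have "t * t ^ i \<noteq> 1" if "i < n" for i
    using t[of "Suc i"] that by simp
  then have "qpoch t t n \<noteq> 0"
    by (auto simp: qpoch_def)
  moreover have "count_list (replicate m (1::nat)) 1 = m" for m
    by (induction m) simp_all
  with n have "v_coeff n (replicate n 1) t = qpoch t t n / (1 - t) ^ n"
    by (simp add: v_coeff_def qpoch_def)
  ultimately show ?thesis
    unfolding HL_BC_def sum using t1 by (simp add: qpoch_def)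
qed

section \<open>The recursion in the number of variables\<close>

text \<open>
  Partial fractions of \<open>v\<^sup>2 \<Prod>\<^sub>i (v - t y\<^sub>i)\<close> at the nodes \<open>-1/b\<close>, \<open>X\<close>, \<open>1/X\<close> and the \<open>y\<^sub>i\<close>.
\<close>

lemma one_variable_identity:
  fixes y :: "'i \<Rightarrow> 'a::field" and X t b :: 'a
  defines "z \<equiv> X + inverse X"
  assumes I: "finite I" and inj: "inj_on y I"
    and X: "X \<noteq> 0" "X ^ 2 \<noteq> 1" and yX: "\<And>i. i \<in> I \<Longrightarrow> y i \<noteq> X \<and> y i * X \<noteq> 1"
    and b: "b \<noteq> 0" "1 + b * X \<noteq> 0" "1 + b * inverse X \<noteq> 0" "\<And>i. i \<in> I \<Longrightarrow> 1 + b * y i \<noteq> 0"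
  shows "b * ((1 + b * X) / (X * (1 - X ^ 2)) * (\<Prod>i\<in>I. (1 - t * y i * X) / (1 - y i * X))
      + (1 + b * inverse X) / (inverse X * (1 - inverse X ^ 2))
        * (\<Prod>i\<in>I. (1 - t * y i * inverse X) / (1 - y i * inverse X))) * (\<Prod>i\<in>I. 1 + b * y i)
    = (b * z + b ^ 2 + 1) * (\<Prod>i\<in>I. 1 + b * y i) - (\<Prod>i\<in>I. 1 + t * b * y i)
      - (b * z + b ^ 2 + 1) * b * (\<Sum>k\<in>I. y k ^ 2 * (y k - t * y k) / ((y k - X) * (y k - inverse X))
          * (\<Prod>i\<in>I - {k}. (y k - t * y i) / (y k - y i) * (1 + b * y i)))"
proof -
  \<comment> \<open>The zero of \<open>1 + b * v\<close>: differences with this node are multiples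
    of \<open>1 + b * v\<close>.\<close>
  define w where "w = - inverse b"
  define D where "D = b * z + b ^ 2 + 1"
  define P where "P = (\<Prod>i\<in>I. 1 + b * y i)"
  define N where "N v = (\<Prod>i\<in>I. v - t * y i)" for v
  have yX': "y i \<noteq> inverse X" if "i \<in> I" for i
    using yX[OF that] X by (auto simp: field_simps)
  have XX': "X \<noteq> inverse X"
    using X by (auto simp: field_simps power2_eq_square)
  have wy: "y i - w = inverse b * (1 + b * y i)" for i
    using b by (simp add: w_def field_simps)
  have wX: "X - w = inverse b * (1 + b * X)" "inverse X - w = inverse b * (1 + b * inverse X)"
    using b by (simp_all add: w_def algebra_simps)
  have "w \<notin> y ` I"
    using b wy by (metis (no_types, lifting) diff_self image_iff inverse_nonzero_iff_nonzero mult_eq_0_iff)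
  moreover have "X - w \<noteq> 0" "inverse X - w \<noteq> 0"
    unfolding wX using b by simp_all
  then have "w \<noteq> X" "w \<noteq> inverse X"
    by auto
  ultimately have "w ^ 2 * N w / ((w - X) * (w - inverse X) * (\<Prod>i\<in>I. w - y i))
    + X ^ 2 * N X / ((X - w) * (X - inverse X) * (\<Prod>i\<in>I. X - y i))
    + inverse X ^ 2 * N (inverse X) / ((inverse X - w) * (inverse X - X) * (\<Prod>i\<in>I. inverse X - y i))
    + (\<Sum>k\<in>I. y k ^ 2 * N (y k)
        / ((y k - w) * (y k - X) * (y k - inverse X) * (\<Prod>i\<in>I - {k}. y k - y i))) = 1"
    (is "?T1 + ?T2 + ?T3 + ?S = 1")
    unfolding N_def using I inj yX yX' XX' by (intro partial_fraction_at_nodes) force+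
  \<comment> \<open>\<open>D\<close> and \<open>P\<close> clear the differences with
    \<open>w\<close> from the denominators: \<open>D\<close> those with \<open>X\<close> and its
    inverse, \<open>P\<close> those with the \<open>y i\<close>.\<close>
  from arg_cong[OF this, of "\<lambda>a. D * P * a"]
  have main: "D * P * ?T1 + D * P * ?T2 + D * P * ?T3 + D * P * ?S = D * P"
    by (simp only: distrib_left mult_1_right)
  have D1: "D = (1 + b * X) * (1 + b * inverse X)"
    using X by (simp add: D_def z_def algebra_simps power2_eq_square)
  then have D2: "D = b ^ 2 * ((X - w) * (inverse X - w))"
    unfolding wX using b(1) by (simp add: field_simps power2_eq_square)
  \<comment> \<open>At the node \<open>w\<close> the prefactor is 1, and \<open>N w\<close> is the
    source of the argument \<open>t * b\<close>.\<close>
  have "D * P * ?T1 = D * w ^ 2 / ((w - X) * (w - inverse X)) * (P * (N w / (\<Prod>i\<in>I. w - y i)))"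
    by simp
  also have "D * w ^ 2 / ((w - X) * (w - inverse X)) = 1"
  proof -
    have "b * w = -1" using b by (simp add: w_def)
    moreover have "D * w ^ 2 = (b * w) ^ 2 * ((w - X) * (w - inverse X))"
      unfolding D2 by (simp add: algebra_simps power2_eq_square)
    ultimately have "D * w ^ 2 = (w - X) * (w - inverse X)"
      by simp
    then show ?thesis
      using \<open>w \<noteq> X\<close> \<open>w \<noteq> inverse X\<close> by simp
  qed
  also have "P * (N w / (\<Prod>i\<in>I. w - y i)) = (\<Prod>i\<in>I. 1 + t * b * y i)"
    unfolding P_def N_def prod_dividef[symmetric] prod.distrib[symmetric]
  proof (intro prod.cong refl)
    fix i assume "i \<in> I"
    then have nz: "1 + b * y i \<noteq> 0"
      using b by simp
    have "w - y i = - inverse b * (1 + b * y i)"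
      using b(1) by (simp add: w_def algebra_simps)
    moreover have "w - t * y i = - inverse b * (1 + t * b * y i)"
      using b(1) by (simp add: w_def field_simps)
    ultimately show "(1 + b * y i) * ((w - t * y i) / (w - y i)) = 1 + t * b * y i"
      using b(1) nz by simp
  qed
  finally have T1: "D * P * ?T1 = (\<Prod>i\<in>I. 1 + t * b * y i)" by simp
  have quot: "N X / (\<Prod>i\<in>I. X - y i) = (\<Prod>i\<in>I. (1 - t * y i * inverse X) / (1 - y i * inverse X))"
    if "X \<noteq> 0" for X
    unfolding N_def prod_dividef[symmetric]
  proof (intro prod.cong refl)
    fix i
    have "X - t * y i = X * (1 - t * y i * inverse X)" "X - y i = X * (1 - y i * inverse X)"
      using that by (simp_all add: algebra_simps)
    then show "(X - t * y i) / (X - y i) = (1 - t * y i * inverse X) / (1 - y i * inverse X)"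
      using that by simp
  qed
  \<comment> \<open>The residue at \<open>u\<close> yields the term for \<open>inverse u\<close>, so
    the nodes \<open>X\<close> and \<open>inverse X\<close> exchange roles.\<close>
  have pole: "D * u ^ 2 / ((u - w) * (u - inverse u))
      = b * ((1 + b * inverse u) / (inverse u * (1 - inverse u ^ 2)))"
    if u: "u = X \<or> u = inverse X" for u
  proof -
    have nz: "u \<noteq> 0" "1 + b * u \<noteq> 0"
      using u X b by auto
    have D: "D = (1 + b * u) * (1 + b * inverse u)"
      using u D1 by auto
    have "u - w = inverse b * (1 + b * u)"
      using u wX by auto
    moreover have "inverse u * (1 - inverse u ^ 2) = (u - inverse u) / u ^ 2"
      using nz by (simp add: field_simps power2_eq_square)
    ultimately show ?thesis
      using nz b(1) unfolding D by simp (simp add: divide_inverse ac_simps)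
  qed
  have "D * P * ?T2 = D * X ^ 2 / ((X - w) * (X - inverse X)) * (N X / (\<Prod>i\<in>I. X - y i)) * P"
    by simp
  then have T2: "D * P * ?T2 = b * ((1 + b * inverse X) / (inverse X * (1 - inverse X ^ 2))
        * (\<Prod>i\<in>I. (1 - t * y i * inverse X) / (1 - y i * inverse X))) * P"
    using pole[of X] quot[of X] X by (simp only: mult.assoc simp_thms)
  have "D * P * ?T3 = D * inverse X ^ 2 / ((inverse X - w) * (inverse X - inverse (inverse X)))
      * (N (inverse X) / (\<Prod>i\<in>I. inverse X - y i)) * P"
    by simp
  then have T3: "D * P * ?T3 = b * ((1 + b * X) / (X * (1 - X ^ 2))
        * (\<Prod>i\<in>I. (1 - t * y i * X) / (1 - y i * X))) * P"
    using pole[of "inverse X"] quot[of "inverse X"] X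
    by (simp only: mult.assoc simp_thms inverse_inverse_eq inverse_nonzero_iff_nonzero)
  have S: "D * P * ?S = D * b * (\<Sum>k\<in>I. y k ^ 2 * (y k - t * y k) / ((y k - X) * (y k - inverse X))
          * (\<Prod>i\<in>I - {k}. (y k - t * y i) / (y k - y i) * (1 + b * y i)))"
    unfolding sum_distrib_left
  proof (intro sum.cong refl)
    fix k assume k: "k \<in> I"
    \<comment> \<open>The factor \<open>1 + b * y k\<close> of \<open>P\<close> cancels completely,
      which makes the later cancellation over signs possible.\<close>
    have residue: "(1 + b * y k) / (y k - w) = b"
      unfolding wy using b(1) b(4)[OF k] by (simp add: divide_inverse)
    have "N (y k) = (y k - t * y k) * (\<Prod>i\<in>I - {k}. y k - t * y i)"
      "P = (1 + b * y k) * (\<Prod>i\<in>I - {k}. 1 + b * y i)"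
      using I k by (simp_all add: N_def P_def prod.remove)
    then have "D * P * (y k ^ 2 * N (y k)
        / ((y k - w) * (y k - X) * (y k - inverse X) * (\<Prod>i\<in>I - {k}. y k - y i)))
      = D * ((1 + b * y k) / (y k - w)) * (y k ^ 2 * (y k - t * y k) / ((y k - X) * (y k - inverse X))
          * ((\<Prod>i\<in>I - {k}. y k - t * y i) / (\<Prod>i\<in>I - {k}. y k - y i) * (\<Prod>i\<in>I - {k}. 1 + b * y i)))"
      by (simp only: times_divide_times_eq times_divide_eq_left times_divide_eq_right divide_divide_eq_left ac_simps)
    then show "D * P * (y k ^ 2 * N (y k)
        / ((y k - w) * (y k - X) * (y k - inverse X) * (\<Prod>i\<in>I - {k}. y k - y i)))
      = D * b * (y k ^ 2 * (y k - t * y k) / ((y k - X) * (y k - inverse X))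
          * (\<Prod>i\<in>I - {k}. (y k - t * y i) / (y k - y i) * (1 + b * y i)))"
      unfolding residue by (simp only: prod_dividef prod.distrib)
  qed
  show ?thesis
    using main unfolding T1 T2 T3 S P_def[symmetric] D_def[symmetric]
    by (simp add: algebra_simps)
qed

lemma core_insert:
  assumes "k < n"
  shows "core n t y = 1 / (y k * (1 - y k ^ 2)) * (\<Prod>i\<in>{..<n} - {k}. (1 - t * y i * y k) / (1 - y i * y k))
    * ((\<Prod>i\<in>{..<n} - {k}. 1 / (y i * (1 - y i ^ 2)))
      * pair_prod (\<lambda>i j. (1 - t * y i * y j) / (1 - y i * y j)) ({..<n} - {k}))"
proof -
  have "pair_prod (\<lambda>i j. (1 - t * y i * y j) / (1 - y i * y j)) (insert k ({..<n} - {k}))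
      = (\<Prod>i\<in>{..<n} - {k}. (1 - t * y i * y k) / (1 - y i * y k))
        * pair_prod (\<lambda>i j. (1 - t * y i * y j) / (1 - y i * y j)) ({..<n} - {k})"
    by (rule pair_prod_insert) (auto simp: mult_ac)
  then show ?thesis
    using assms unfolding core_def by (simp add: insert_absorb prod.remove[of "{..<n}" k])
qed

text \<open>The residue at \<open>y\<^sub>k\<close> changes sign under \<open>x\<^sub>k \<mapsto> 1/x\<^sub>k\<close>.\<close>

lemma signed_residues_cancel:
  fixes x :: "nat \<Rightarrow> 'a::field"
  assumes gen: "generic n x" and k: "k < n" and X: "X \<noteq> 0" "x k \<noteq> X" "x k * X \<noteq> 1"
  shows "(\<Sum>A\<in>Pow {..<n}. let y = signed x A in core n t y *
      (y k ^ 2 * (y k - t * y k) / ((y k - X) * (y k - inverse X))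
        * (\<Prod>i\<in>{..<n} - {k}. (y k - t * y i) / (y k - y i) * (1 + b * y i)))) = 0"
proof -
  define J where "J = {..<n} - {k}"
  \<comment> \<open>\<open>\<alpha>\<close> collects the factors in \<open>y k\<close> alone,
    \<open>\<beta>\<close> those coupling \<open>y k\<close> to another variable,
    \<open>\<rho>\<close> those free of \<open>y k\<close>.\<close>
  define \<alpha> where "\<alpha> v = 1 / (v * (1 - v ^ 2)) * (v ^ 2 * (v - t * v) / ((v - X) * (v - inverse X)))" for v
  define \<beta> where "\<beta> u v = (1 - t * u * v) / (1 - u * v) * ((v - t * u) / (v - u))" for u v
  define \<rho> where "\<rho> y = (\<Prod>i\<in>J. 1 / (y i * (1 - y i ^ 2))) * (\<Prod>i\<in>J. 1 + b * y i)
      * pair_prod (\<lambda>i j. (1 - t * y i * y j) / (1 - y i * y j)) J" for y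
  define R where "R y = core n t y * (y k ^ 2 * (y k - t * y k) / ((y k - X) * (y k - inverse X))
        * (\<Prod>i\<in>J. (y k - t * y i) / (y k - y i) * (1 + b * y i)))" for y
  have R: "R y = \<alpha> (y k) * (\<Prod>i\<in>J. \<beta> (y i) (y k)) * \<rho> y" for y
    unfolding R_def \<alpha>_def \<beta>_def \<rho>_def core_insert[OF k] J_def by (simp only: prod.distrib ac_simps)
  have xk: "x k \<noteq> 0" "x k ^ 2 \<noteq> 1"
    using gen k by (auto simp: generic_def)
  have \<alpha>: "\<alpha> (inverse (x k)) = - \<alpha> (x k)"
  proof -
    \<comment> \<open>Here the first fraction is invariant under
      \<open>v \<mapsto> inverse v\<close> and the second is odd.\<close>
    have "\<alpha> v = (1 - t) / (X + inverse X - v - inverse v) * (1 / (v - inverse v))"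
      if "v \<noteq> 0" "v ^ 2 \<noteq> 1" "v \<noteq> X" "v \<noteq> inverse X" for v
    proof -
      have "v * (1 - v ^ 2) = - (v ^ 2) * (v - inverse v)"
        using that by (simp add: algebra_simps power2_eq_square)
      moreover have "(v - X) * (v - inverse X) = - v * (X + inverse X - v - inverse v)"
        using that X by (simp add: algebra_simps)
      moreover have "v - t * v = v * (1 - t)"
        by (simp add: algebra_simps)
      ultimately show ?thesis
        unfolding \<alpha>_def using that by simp
    qed
    note \<alpha>_eq = this
    have "x k \<noteq> inverse X" "inverse (x k) \<noteq> X" "inverse (x k) \<noteq> inverse X"
      using X xk by (auto simp: field_simps)
    then have 1: "\<alpha> (x k) = (1 - t) / (X + inverse X - x k - inverse (x k)) * (1 / (x k - inverse (x k)))"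
      and 2: "\<alpha> (inverse (x k)) = (1 - t) / (X + inverse X - inverse (x k) - x k) * (1 / (inverse (x k) - x k))"
      using \<alpha>_eq[of "x k"] \<alpha>_eq[of "inverse (x k)"] X xk by (simp_all add: power_inverse)
    have "X + inverse X - inverse (x k) - x k = X + inverse X - x k - inverse (x k)"
      by (simp add: algebra_simps)
    moreover have "1 / (inverse (x k) - x k) = - (1 / (x k - inverse (x k)))"
      by (metis minus_diff_eq minus_divide_right)
    ultimately show ?thesis
      unfolding 1 2 by simp
  qed
  \<comment> \<open>Inverting \<open>x k\<close> merely exchanges the two fractions in
    \<open>\<beta>\<close>.\<close>
  have \<beta>: "\<beta> u (inverse (x k)) = \<beta> u (x k)" for u
  proof -
    have eqs: "1 - t * u * inverse (x k) = inverse (x k) * (x k - t * u)"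
      "1 - u * inverse (x k) = inverse (x k) * (x k - u)"
      "inverse (x k) - t * u = inverse (x k) * (1 - t * u * x k)"
      "inverse (x k) - u = inverse (x k) * (1 - u * x k)"
      using xk by (simp_all add: algebra_simps)
    have "inverse (x k) \<noteq> 0"
      using xk by simp
    then show ?thesis
      unfolding \<beta>_def eqs by (simp only: mult_divide_mult_cancel_left mult.commute simp_thms)
  qed
  have "R (signed x A) + R (signed x (insert k A)) = 0" if A: "A \<in> Pow J" for A
  proof -
    have same: "signed x (insert k A) i = signed x A i" if "i \<in> J" for i
      using that by (auto simp: signed_def J_def)
    have "signed x A k = x k" "signed x (insert k A) k = inverse (x k)"
      using A by (auto simp: signed_def J_def)
    moreover have "\<rho> (signed x (insert k A)) = \<rho> (signed x A)"
      unfolding \<rho>_def using same by (simp cong: prod.cong pair_prod_cong)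
    moreover have "(\<Prod>i\<in>J. \<beta> (signed x (insert k A) i) v) = (\<Prod>i\<in>J. \<beta> (signed x A i) v)" for v
      using same by (simp cong: prod.cong)
    ultimately show ?thesis
      unfolding R by (simp add: \<alpha> \<beta>)
  qed
  then have "(\<Sum>A\<in>Pow (insert k J). R (signed x A)) = 0"
    by (subst sum_Pow_insert) (auto simp: J_def)
  moreover have "insert k J = {..<n}"
    using k by (auto simp: J_def)
  ultimately show ?thesis
    by (simp add: R_def J_def Let_def)
qed

text \<open>The sets \<open>A\<close> and \<open>insert n A\<close> differ only in the sign of
  \<open>x n\<close>. \<open>one_variable_identity\<close> evaluates each such pair, and its terms
  from the nodes \<open>y k\<close> cancel in the sum over \<open>A\<close>. The factor
  \<open>b\<close> avoids a division.\<close>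

lemma sign_sum_Suc:
  fixes x :: "nat \<Rightarrow> 'a::field"
  assumes gen: "generic (Suc n) x" and b: "b \<noteq> 0"
    and bx: "\<And>i. i < Suc n \<Longrightarrow> 1 + b * x i \<noteq> 0 \<and> 1 + b * inverse (x i) \<noteq> 0"
  shows "b * sign_sum (Suc n) x t b
    = (b * (x n + inverse (x n)) + b ^ 2 + 1) * sign_sum n x t b - sign_sum n x t (t * b)"
proof -
  define D where "D = b * (x n + inverse (x n)) + b ^ 2 + 1"
  define \<kappa> where "\<kappa> X y = (1 + b * X) / (X * (1 - X ^ 2)) * (\<Prod>i<n. (1 - t * y i * X) / (1 - y i * X))"
    for X and y :: "nat \<Rightarrow> 'a"
  define G where "G y k = y k ^ 2 * (y k - t * y k) / ((y k - x n) * (y k - inverse (x n)))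
          * (\<Prod>i\<in>{..<n} - {k}. (y k - t * y i) / (y k - y i) * (1 + b * y i))" for y :: "nat \<Rightarrow> 'a" and k
  have gen_n: "generic n x"
    using gen by (auto simp: generic_def)
  have X: "x n \<noteq> 0" "x n ^ 2 \<noteq> 1" and xX: "\<And>i. i < n \<Longrightarrow> x i \<noteq> x n \<and> x i * x n \<noteq> 1"
    using gen by (auto simp: generic_def)
  have step: "core (Suc n) t y * (\<Prod>i<Suc n. 1 + b * y i) = \<kappa> (y n) y * core n t y * (\<Prod>i<n. 1 + b * y i)" for y
  proof -
    have "{..<Suc n} - {n} = {..<n}" by auto
    then show ?thesis
      by (simp add: core_insert[of n "Suc n"] core_def[of n] \<kappa>_def)
  qed
  have pair: "b * (core (Suc n) t (signed x A) * (\<Prod>i<Suc n. 1 + b * signed x A i)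
      + core (Suc n) t (signed x (insert n A)) * (\<Prod>i<Suc n. 1 + b * signed x (insert n A) i))
    = D * (core n t (signed x A) * (\<Prod>i<n. 1 + b * signed x A i))
      - core n t (signed x A) * (\<Prod>i<n. 1 + t * b * signed x A i)
      - D * b * (\<Sum>k<n. core n t (signed x A) * G (signed x A) k)"
    if A: "A \<in> Pow {..<n}" for A
  proof -
    let ?y = "signed x A" and ?y' = "signed x (insert n A)"
    have same: "?y' i = ?y i" if "i < n" for i
      using that by (auto simp: signed_def)
    have "pair_prod (\<lambda>i j. (1 - t * ?y' i * ?y' j) / (1 - ?y' i * ?y' j)) {..<n}
        = pair_prod (\<lambda>i j. (1 - t * ?y i * ?y j) / (1 - ?y i * ?y j)) {..<n}"
      using same by (intro pair_prod_cong) simp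
    then have core: "core n t ?y' = core n t ?y"
      unfolding core_def using same by simp
    have "\<kappa> v ?y' = \<kappa> v ?y" for v
      unfolding \<kappa>_def using same by simp
    moreover have "?y n = x n" "?y' n = inverse (x n)"
      using A by (auto simp: signed_def)
    ultimately have "b * (core (Suc n) t ?y * (\<Prod>i<Suc n. 1 + b * ?y i)
        + core (Suc n) t ?y' * (\<Prod>i<Suc n. 1 + b * ?y' i))
      = core n t ?y * (b * (\<kappa> (x n) ?y + \<kappa> (inverse (x n)) ?y) * (\<Prod>i<n. 1 + b * ?y i))"
      unfolding step core using same by (simp add: algebra_simps)
    also have "b * (\<kappa> (x n) ?y + \<kappa> (inverse (x n)) ?y) * (\<Prod>i<n. 1 + b * ?y i)
      = D * (\<Prod>i<n. 1 + b * ?y i) - (\<Prod>i<n. 1 + t * b * ?y i) - D * b * (\<Sum>k<n. G ?y k)"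
      unfolding \<kappa>_def D_def G_def
    proof (intro one_variable_identity)
      show "inj_on ?y {..<n}"
        using generic_signed[OF gen_n, of A] by (auto simp: inj_on_def generic_def)
      fix i assume i: "i \<in> {..<n}"
      then have "x i \<noteq> 0"
        using gen_n by (auto simp: generic_def)
      then show "?y i \<noteq> x n \<and> ?y i * x n \<noteq> 1"
        using xX[of i] i by (auto simp: signed_def field_simps)
      show "1 + b * ?y i \<noteq> 0"
        using bx[of i] i by (auto simp: signed_def)
    qed (use X b bx[of n] in auto)
    finally show ?thesis
      by (simp add: algebra_simps sum_distrib_left)
  qed
  have "b * sign_sum (Suc n) x t b
      = (\<Sum>A\<in>Pow {..<n}. D * (core n t (signed x A) * (\<Prod>i<n. 1 + b * signed x A i))
      - core n t (signed x A) * (\<Prod>i<n. 1 + t * b * signed x A i)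
      - D * b * (\<Sum>k<n. core n t (signed x A) * G (signed x A) k))"
  proof -
    have "sign_sum (Suc n) x t b = (\<Sum>A\<in>Pow (insert n {..<n}).
        core (Suc n) t (signed x A) * (\<Prod>i<Suc n. 1 + b * signed x A i))"
      by (simp only: sign_sum_def lessThan_Suc)
    also have "\<dots> = (\<Sum>A\<in>Pow {..<n}.
        core (Suc n) t (signed x A) * (\<Prod>i<Suc n. 1 + b * signed x A i)
        + core (Suc n) t (signed x (insert n A)) * (\<Prod>i<Suc n. 1 + b * signed x (insert n A) i))"
      by (rule sum_Pow_insert) simp_all
    finally have "b * sign_sum (Suc n) x t b = (\<Sum>A\<in>Pow {..<n}.
        b * (core (Suc n) t (signed x A) * (\<Prod>i<Suc n. 1 + b * signed x A i)
        + core (Suc n) t (signed x (insert n A)) * (\<Prod>i<Suc n. 1 + b * signed x (insert n A) i)))"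
      by (simp only: sum_distrib_left)
    also have "\<dots> = (\<Sum>A\<in>Pow {..<n}. D * (core n t (signed x A) * (\<Prod>i<n. 1 + b * signed x A i))
      - core n t (signed x A) * (\<Prod>i<n. 1 + t * b * signed x A i)
      - D * b * (\<Sum>k<n. core n t (signed x A) * G (signed x A) k))"
      by (rule sum.cong[OF refl]) (rule pair)
    finally show ?thesis .
  qed
  also have "\<dots> = D * sign_sum n x t b - sign_sum n x t (t * b)
      - D * b * (\<Sum>A\<in>Pow {..<n}. \<Sum>k<n. core n t (signed x A) * G (signed x A) k)"
    by (simp only: sign_sum_def sum_subtractf sum_distrib_left)
  \<comment> \<open>The cancellation takes place over signs for fixed \<open>k\<close>, so the sums
    are exchanged.\<close>
  also have "(\<Sum>A\<in>Pow {..<n}. \<Sum>k<n. core n t (signed x A) * G (signed x A) k)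
      = (\<Sum>k<n. \<Sum>A\<in>Pow {..<n}. core n t (signed x A) * G (signed x A) k)"
    by (rule sum.swap)
  also have "\<dots> = 0"
  proof (rule sum.neutral, rule ballI)
    fix k assume "k \<in> {..<n}"
    then show "(\<Sum>A\<in>Pow {..<n}. core n t (signed x A) * G (signed x A) k) = 0"
      unfolding G_def using X(1) xX[of k]
      by (intro signed_residues_cancel[OF gen_n, unfolded Let_def]) simp_all
  qed
  finally show ?thesis
    by (simp add: D_def)
qed

section \<open>Expansion in the t-Fibonacci polynomials\<close>

text \<open>For \<open>0 \<le> k \<le> n\<close> this is the character of the symplectic group
  \<open>Sp(2n)\<close> belonging to a column of \<open>n - k\<close> boxes.\<close>

definition e_diff :: "nat \<Rightarrow> (nat \<Rightarrow> 'a::field) \<Rightarrow> int \<Rightarrow> 'a" where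
  "e_diff n x k = e_dot n (int n - k) x - e_dot n (int n - k - 2) x"

lemma e_diff_Suc:
  assumes "x n \<noteq> 0"
  shows "e_diff (Suc n) x k = e_diff n x (k - 1) + (x n + inverse (x n)) * e_diff n x k + e_diff n x (k + 1)"
proof -
  have "int (Suc n) - k = int n - (k - 1)" "int n - (k - 1) - 1 = int n - k" "int n - (k - 1) - 2 = int n - (k + 1)"
    "int (Suc n) - k - 2 = int n - (k - 1) - 2" "int n - (k - 1) - 2 - 1 = int n - k - 2"
    "int n - (k - 1) - 2 - 2 = int n - (k + 1) - 2"
    by simp_all
  then show ?thesis
    unfolding e_diff_def using assms by (simp add: e_dot_Suc algebra_simps)
qed

text \<open>Symmetry about degree \<open>n\<close>; this removes the boundary term at the lower end
  of the expansion.\<close>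

lemma e_diff_minus_1:
  assumes "\<And>i. i < n \<Longrightarrow> x i \<noteq> 0"
  shows "e_diff n x (- 1) = 0"
  using e_dot_symmetric[of n x 1] assms by (simp add: e_diff_def)

lemma e_diff_gt: "k > int n \<Longrightarrow> e_diff n x k = 0"
  by (simp add: e_diff_def e_dot_negative)

lemma sign_sum_poly: "\<exists>p. \<forall>b. sign_sum n x t b = poly p b"
  by (intro exI[of _ "\<Sum>A\<in>Pow {..<n}. smult (core n t (signed x A)) (\<Prod>i<n. [:1, signed x A i:])"])
    (simp add: sign_sum_def poly_sum poly_prod)

text \<open>Both sides are 1 for \<open>n = 0\<close> and obey the same recursion in
  \<open>n\<close>: on the right, \<open>e_diff_Suc\<close> and summation by parts bring
  neighbouring \<open>psi\<close> together, and \<open>psi_three_term\<close> rewrites them through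
  values at \<open>b\<close> and \<open>t * b\<close>.\<close>

lemma sign_sum_expansion:
  fixes x :: "nat \<Rightarrow> 'a::field_char_0"
  assumes t: "t = s ^ 2" and gen: "generic n x"
  shows "sign_sum n x t b = (\<Sum>k<Suc n. psi s k b * e_diff n x (int k))"
  using gen
proof (induction n arbitrary: b)
  case 0
  then show ?case
    by (simp add: sign_sum_def core_def e_diff_def e_dot_0)
next
  case (Suc n)
  define z where "z = x n + inverse (x n)"
  define E where "E k = e_diff n x k" for k
  have x0: "x i \<noteq> 0" if "i < Suc n" for i
    using Suc.prems that by (simp add: generic_def)
  have "generic n x"
    using Suc.prems by (simp add: generic_def)
  note IH = Suc.IH[OF this]
  have rhs: "b * (\<Sum>k<Suc (Suc n). psi s k b * e_diff (Suc n) x (int k))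
      = (b * z + b ^ 2 + 1) * sign_sum n x t b - sign_sum n x t (t * b)" for b
  proof -
    \<comment> \<open>The values just outside \<open>0..n\<close> vanish, so the index shifts below
      lose no terms.\<close>
    have E0: "E (- 1) = 0" "E (int (Suc n)) = 0" "E (int n + 1) = 0" "E (int (Suc n) + 1) = 0"
      using x0 by (simp_all add: E_def e_diff_minus_1 e_diff_gt)
    have "(\<Sum>k<Suc (Suc n). psi s k b * e_diff (Suc n) x (int k))
        = (\<Sum>k<Suc (Suc n). psi s k b * E (int k - 1)) + z * (\<Sum>k<Suc (Suc n). psi s k b * E (int k))
          + (\<Sum>k<Suc (Suc n). psi s k b * E (int k + 1))"
      using x0[of n] by (simp only: e_diff_Suc E_def z_def lessI simp_thms sum_distrib_left
        sum.distrib[symmetric] distrib_left distrib_right ac_simps)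
    also have "(\<Sum>k<Suc (Suc n). psi s k b * E (int k - 1)) = (\<Sum>k<Suc n. psi s (Suc k) b * E (int k))"
      by (subst sum.lessThan_Suc_shift) (simp add: E0 del: psi.simps(3) sum.lessThan_Suc)
    also have "\<dots> = b * E 0 + (\<Sum>k<n. psi s (Suc (Suc k)) b * E (1 + int k))"
      by (subst sum.lessThan_Suc_shift) (simp del: psi.simps(3) sum.lessThan_Suc)
    also have "(\<Sum>k<Suc (Suc n). psi s k b * E (int k)) = (\<Sum>k<Suc n. psi s k b * E (int k))"
      by (simp only: sum.lessThan_Suc E0 mult_zero_right add_0_right)
    also have "(\<Sum>k<Suc (Suc n). psi s k b * E (int k + 1)) = (\<Sum>k<n. psi s k b * E (1 + int k))"
      by (simp only: sum.lessThan_Suc E0 mult_zero_right add_0_right add.commute[of 1])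
    finally have 1: "b * (\<Sum>k<Suc (Suc n). psi s k b * e_diff (Suc n) x (int k))
        = b * z * (\<Sum>k<Suc n. psi s k b * E (int k)) + b ^ 2 * E 0
          + (\<Sum>k<n. b * (psi s (Suc (Suc k)) b + psi s k b) * E (1 + int k))"
      by (simp add: algebra_simps sum.distrib sum_distrib_left power2_eq_square
          del: psi.simps(3) sum.lessThan_Suc)
    have "(b ^ 2 + 1) * (\<Sum>k<Suc n. psi s k b * E (int k)) - (\<Sum>k<Suc n. psi s k (t * b) * E (int k))
        = (\<Sum>k<Suc n. ((b ^ 2 + 1) * psi s k b - psi s k (t * b)) * E (int k))"
      by (simp only: sum_distrib_left sum_subtractf[symmetric] left_diff_distrib mult.assoc)
    \<comment> \<open>Index 0 stands apart because \<open>psi_three_term\<close> starts at index 1;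
      its coefficient is \<open>b ^ 2 + 1 - 1\<close>.\<close>
    also have "\<dots> = b ^ 2 * E 0 + (\<Sum>k<n. b * (psi s (Suc (Suc k)) b + psi s k b) * E (1 + int k))"
      unfolding psi_three_term[OF t]
      by (subst sum.lessThan_Suc_shift) (simp del: psi.simps(3) sum.lessThan_Suc)
    finally show ?thesis
      unfolding 1 IH E_def[symmetric] by (simp only: distrib_right) (simp add: algebra_simps del: sum.lessThan_Suc)
  qed
  obtain p where p: "\<And>b. sign_sum (Suc n) x t b = poly p b"
    using sign_sum_poly by metis
  have "\<forall>k. \<exists>P. \<forall>b. psi s k b = poly P b"
    by (rule allI) (rule psi_poly)
  from choice[OF this] obtain P where P: "\<And>k b. psi s k b = poly (P k) b"
    by blast
  define q where "q = (\<Sum>k<Suc (Suc n). smult (e_diff (Suc n) x (int k)) (P k))"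
  have q: "(\<Sum>k<Suc (Suc n). psi s k b * e_diff (Suc n) x (int k)) = poly q b" for b
    unfolding q_def poly_sum poly_smult P by (rule sum.cong[OF refl]) (rule mult.commute)
  \<comment> \<open>The recursion needs \<open>b\<close> generic, but the induction applies it at \<open>t b\<close>, so the identity is
    extended to all \<open>b\<close> before the next step.\<close>
  have "p = q"
  proof (rule poly_eqI_cofinite)
    show "finite (insert 0 ((\<lambda>i. - inverse (x i)) ` {..<Suc n} \<union> (\<lambda>i. - x i) ` {..<Suc n}))"
      by simp
    fix b assume b: "b \<notin> insert 0 ((\<lambda>i. - inverse (x i)) ` {..<Suc n} \<union> (\<lambda>i. - x i) ` {..<Suc n})"
    have "1 + b * x i \<noteq> 0 \<and> 1 + b * inverse (x i) \<noteq> 0" if i: "i < Suc n" for i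
    proof -
      have "b = - inverse (x i)" if "1 + b * x i = 0"
        using that x0[OF i] by (simp add: field_simps eq_neg_iff_add_eq_0)
      moreover have "b = - x i" if "1 + b * inverse (x i) = 0"
        using that x0[OF i] by (simp add: field_simps eq_neg_iff_add_eq_0)
      ultimately show ?thesis
        using b i by blast
    qed
    then have "b * poly p b = b * poly q b"
      using b rhs[of b] sign_sum_Suc[OF Suc.prems, of b t] by (simp add: p q z_def del: sum.lessThan_Suc)
    then show "poly p b = poly q b"
      using b by simp
  qed
  then show ?case
    by (simp only: p q)
qed

section \<open>Collapse to the pentagonal sum\<close>

text \<open>Terms are matched by \<open>k\<close> modulo 3: \<open>k = 3 * j\<close> gives
  \<open>y = - j\<close>, \<open>k = 3 * j + 1\<close> gives \<open>y = j + 1\<close>, and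
  \<open>k = 3 * j + 2\<close> drops out by \<open>psi_at_s\<close>.\<close>

lemma psi_e_diff_sum:
  fixes x :: "nat \<Rightarrow> 'a::field" and s :: 'a
  assumes x: "\<And>i. i < n \<Longrightarrow> x i \<noteq> 0"
  shows "(\<Sum>k<3 * N + 1. psi s k s * e_diff n x (int k))
    = (\<Sum>y\<in>{- int N..int N}. (-1) powi y * s powi (3 * y ^ 2 - 2 * y) *
        (e_dot n (int n - 3 * y) x - e_dot n (int n + 2 - 3 * y) x))"
proof -
  define f where "f y = (-1) powi y * s powi (3 * y ^ 2 - 2 * y) *
        (e_dot n (int n - 3 * y) x - e_dot n (int n + 2 - 3 * y) x)" for y
  have neg: "f (- int j) = psi s (3 * j) s * e_diff n x (int (3 * j))" for j
  proof -
    have "3 * (- int j) ^ 2 - 2 * (- int j) = int (3 * j ^ 2 + 2 * j)"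
      by simp
    then have "f (- int j) = (-1) ^ j * s ^ (3 * j ^ 2 + 2 * j) *
        (e_dot n (int n - 3 * (- int j)) x - e_dot n (int n + 2 - 3 * (- int j)) x)"
      unfolding f_def by (simp only: power_int_of_nat power_int_minus) (simp add: power_inverse[symmetric])
    \<comment> \<open>The degrees \<open>n + 3 * j\<close> and \<open>n + 3 * j + 2\<close> are
      reflected about \<open>n\<close>.\<close>
    moreover have "e_dot n (int n - 3 * (- int j)) x = e_dot n (int n - int (3 * j)) x"
      using e_dot_symmetric[of n x "3 * int j"] x by simp
    moreover have "e_dot n (int n + 2 - 3 * (- int j)) x = e_dot n (int n - int (3 * j) - 2) x"
      using e_dot_symmetric[of n x "3 * int j + 2"] x by (simp add: algebra_simps)
    ultimately show ?thesis
      by (simp only: psi_at_s e_diff_def)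
  qed
  have pos: "f (1 + int j) = psi s (3 * j + 1) s * e_diff n x (int (3 * j + 1))" for j
  proof -
    have 1: "1 + int j = int (Suc j)" "3 * int (Suc j) ^ 2 - 2 * int (Suc j) = int (3 * j ^ 2 + 4 * j + 1)"
      by (simp_all add: power2_eq_square algebra_simps)
    \<comment> \<open>The two degrees of \<open>e_diff\<close> occur in opposite order; this swap
      accounts for \<open>(-1) ^ Suc j\<close> against \<open>(-1) ^ j\<close>.\<close>
    have 2: "int n - 3 * int (Suc j) = int n - int (3 * j + 1) - 2" "int n + 2 - 3 * int (Suc j) = int n - int (3 * j + 1)"
      by simp_all
    show ?thesis
      unfolding 1(1) f_def 1(2) 2 psi_at_s e_diff_def power_int_of_nat by (simp add: algebra_simps)
  qed
  have "(\<Sum>k<3 * N + 1. psi s k s * e_diff n x (int k)) = (\<Sum>y\<in>{- int N..int N}. f y)"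
  proof (induction N)
    case 0
    then show ?case
      using neg[of 0] by simp
  next
    case (Suc N)
    have "3 * Suc N + 1 = Suc (Suc (Suc (3 * N + 1)))"
      by simp
    then have "(\<Sum>k<3 * Suc N + 1. psi s k s * e_diff n x (int k)) = (\<Sum>y\<in>{- int N..int N}. f y)
        + psi s (3 * N + 1) s * e_diff n x (int (3 * N + 1))
        + psi s (3 * N + 2) s * e_diff n x (int (3 * N + 2))
        + psi s (3 * Suc N) s * e_diff n x (int (3 * Suc N))"
      unfolding Suc.IH[symmetric] by (simp only: sum.lessThan_Suc) (simp add: numeral_3_eq_3 del: psi.simps)
    also have "\<dots> = f (1 + int N) + (f (- int (Suc N)) + (\<Sum>y\<in>{- int N..int N}. f y))"
      unfolding pos[of N] neg[of "Suc N"] psi_at_s(3) mult_zero_left add_0_right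
      by (simp only: add.assoc add.commute add.left_commute)
    also have "\<dots> = (\<Sum>y\<in>insert (1 + int N) (insert (- int (Suc N)) {- int N..int N}). f y)"
      by simp
    also have "insert (1 + int N) (insert (- int (Suc N)) {- int N..int N}) = {- int (Suc N)..int (Suc N)}"
      by auto
    finally show ?case .
  qed
  then show ?thesis
    by (simp only: f_def)
qed

text \<open>The exponent \<open>3 * y ^ 2 - 2 * y\<close> is twice that of \<open>t\<close> and
  never negative at integers. \<open>Sum_any\<close> is a genuine finite sum, since the terms vanish
  outside \<open>- n \<le> y \<le> n\<close>.\<close>

theorem lemma4p3:
  fixes n :: nat and x :: "nat \<Rightarrow> 'a::field_char_0" and t sqrt_t :: 'a
  assumes "n \<ge> 1"
    and "sqrt_t ^ 2 = t"
    and "\<And>k. 1 \<le> k \<Longrightarrow> k \<le> n \<Longrightarrow> t ^ k \<noteq> 1"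
    and "\<And>i. i < n \<Longrightarrow> x i \<noteq> 0"
    and "\<And>i. i < n \<Longrightarrow> x i ^ 2 \<noteq> 1"
    and "\<And>i j. i < j \<Longrightarrow> j < n \<Longrightarrow> x i \<noteq> x j"
    and "\<And>i j. i < j \<Longrightarrow> j < n \<Longrightarrow> x i * x j \<noteq> 1"
  shows "HL_BC n (replicate n 1) x t (- sqrt_t) 0 =
    Sum_any (\<lambda>y::int. (-1) powi y * sqrt_t powi (3 * y ^ 2 - 2 * y) *
      (e_dot n (int n - 3 * y) x - e_dot n (int n + 2 - 3 * y) x))"
proof -
  let ?f = "\<lambda>y::int. (-1) powi y * sqrt_t powi (3 * y ^ 2 - 2 * y) *
      (e_dot n (int n - 3 * y) x - e_dot n (int n + 2 - 3 * y) x)"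
  have gen: "generic n x"
    unfolding generic_def using assms(4-7) by (metis linorder_neqE_nat mult.commute)
  have vanish: "e_dot n r x = 0" if "r > 2 * int n" for r
    using e_dot_symmetric[of n x "r - int n"] assms(4) that by (simp add: e_dot_negative)
  have zero: "?f y = 0" if "y \<notin> {- int n..int n}" for y
    using that assms(1) by (auto simp: not_le e_dot_negative vanish)
  have "HL_BC n (replicate n 1) x t (- sqrt_t) 0 = sign_sum n x t sqrt_t"
    using assms(1,3) gen by (rule HL_BC_column)
  also have "\<dots> = (\<Sum>k<Suc n. psi sqrt_t k sqrt_t * e_diff n x (int k))"
    using assms(2) gen by (intro sign_sum_expansion) simp_all
  \<comment> \<open>Padding with terms beyond \<open>n\<close>, where \<open>e_diff\<close>
    vanishes, fits the range to \<open>psi_e_diff_sum\<close> with \<open>N = n\<close>.\<close>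
  also have "\<dots> = (\<Sum>k<3 * n + 1. psi sqrt_t k sqrt_t * e_diff n x (int k))"
    by (intro sum.mono_neutral_left) (auto simp: e_diff_gt)
  also have "\<dots> = sum ?f {- int n..int n}"
    using assms(4) by (rule psi_e_diff_sum)
  also have "\<dots> = Sum_any ?f"
    by (rule Sum_any.expand_superset[symmetric]) (simp, use zero in blast)
  finally show ?thesis .
qed

end
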